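(* Let $\mathcal H$ be a separable Hilbert space, $J$ a countable index set, $I=\{1,\dots,m\}$ with $m\ge2$. Let $F=\{f_j\}_{j\in J}$ be a frame for $\mathcal H$ with bounds $A,B$, and let $\{U_i\}_{i\in I}\subset L(\mathcal H)$. For any $k\in I$, if $U_k$ has a left inverse $V\in L(\mathcal H)$ and $$\max_{i\ne k}\|U_k-U_i\|<\sqrt{\frac{A}{(m-1)B}}\cdot\frac1{\|V\|},$$ then the family of frames $\{U_iF\}_{i\in I}$, where $U_iF=\{U_if_j\}_{j\in J}$, is woven.
   Context: $L(\mathcal H)$ is the space of bounded linear operators on $\mathcal H$; $V$ is a left inverse of $U_k$ if $VU_k=I_{\mathcal H}$. A sequence $\{f_j\}_{j\in J}$ in $\mathcal H$ is a frame for $\mathcal H$ with lower and upper bounds $A,B>0$ if $A\|f\|^2\le\sum_{j\in J}|\langle f,f_j\rangle|^2\le B\|f\|^2$ for all $f\in\mathcal H$. A partition $\{\sigma_i\}_{i\in I}$ of $J$ is a family of pairwise disjoint (possibly empty) subsets of $J$ with union $J$. A family of frames $\{F_i=\{f_{ij}\}_{j\in J}\}_{i\in I}$ is woven if there are universal constants $A',B'>0$ such that for every partition $\{\sigma_i\}_{i\in I}$ of $J$ the family $\{f_{ij}\}_{j\in\sigma_i,i\in I}$ is a frame for $\mathcal H$ with bounds $A'$ and $B'$.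
   Formalization: Each U_iF is assumed to be a frame, as "family of frames" suggests; a left inverse of U_k alone does not give this: if F is an orthonormal basis of l2 and all U_i are the right shift, U_kF is not a frame. *)

theory Defs
  imports "HOL-Analysis.Analysis"
begin

text \<open>
  The scalar field is either the reals or the complex numbers. Both are covered at once by a
  class of normed fields with a conjugation; up to isometric isomorphism they are the only
  instances (Gelfand-Mazur), since \<open>real_normed_field\<close> has a multiplicative norm. Note that
  \<open>scalar_cnj_mult\<close> already determines the conjugation.
\<close>

class scalar_field = real_normed_field +
  fixes scalar_cnj :: "'a \<Rightarrow> 'a"
  assumes scalar_cnj_add: "scalar_cnj (x + y) = scalar_cnj x + scalar_cnj y"
    and scalar_cnj_times: "scalar_cnj (x * y) = scalar_cnj x * scalar_cnj y"
    and scalar_cnj_cnj: "scalar_cnj (scalar_cnj x) = x"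
    and scalar_cnj_mult: "x * scalar_cnj x = (norm x)\<^sup>2 *\<^sub>R 1"

instantiation real :: scalar_field
begin
definition scalar_cnj_real :: "real \<Rightarrow> real" where "scalar_cnj_real x = x"
instance
  by standard (auto simp: scalar_cnj_real_def power2_eq_square)
end

instantiation complex :: scalar_field
begin
definition scalar_cnj_complex :: "complex \<Rightarrow> complex" where "scalar_cnj_complex x = cnj x"
instance
  by standard (auto simp: scalar_cnj_complex_def scaleR_conv_of_real complex_norm_square simp del: of_real_power)
end

text \<open>
  A Hilbert space over \<open>'k\<close>: completeness comes from the class \<open>banach\<close>, whose norm is required
  to be the one of the inner product. The inner product is linear in its first argument.
\<close>

locale hilbert_space = vector_space scl
  for scl :: "'k::scalar_field \<Rightarrow> 'a::banach \<Rightarrow> 'a" +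
  fixes ip :: "'a \<Rightarrow> 'a \<Rightarrow> 'k"
  assumes scl_of_real: "scl (of_real r) x = r *\<^sub>R x"
    and ip_add_left: "ip (x + y) z = ip x z + ip y z"
    and ip_scl_left: "ip (scl c x) y = c * ip x y"
    and ip_commute: "ip y x = scalar_cnj (ip x y)"
    and ip_self: "ip x x = of_real ((norm x)\<^sup>2)"

lemma hilbert_space_real_inner:
  "hilbert_space (scaleR :: real \<Rightarrow> 'a \<Rightarrow> 'a::{banach, real_inner}) inner"
  by unfold_locales
    (auto simp: algebra_simps inner_commute scalar_cnj_real_def power2_norm_eq_inner)

lemma hilbert_space_complex:
  "hilbert_space ((*) :: complex \<Rightarrow> complex \<Rightarrow> complex) (\<lambda>x y. x * cnj y)"
  by unfold_locales
    (auto simp: algebra_simps scalar_cnj_complex_def scaleR_conv_of_real complex_norm_square simp del: of_real_power)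

text \<open>
  Membership in \<open>L(H)\<close>. The constant \<open>bounded_linear\<close> only expresses linearity over the reals,
  so linearity over the scalar field is required separately.
\<close>

definition bounded_operator :: "('k::scalar_field \<Rightarrow> 'a::banach \<Rightarrow> 'a) \<Rightarrow> ('a \<Rightarrow> 'a) \<Rightarrow> bool" where
  "bounded_operator scl U \<longleftrightarrow> Vector_Spaces.linear scl scl U \<and> bounded_linear U"

text \<open>
  Summability is part of the upper bound: \<open>infsum\<close> is \<open>0\<close> for divergent sums.
\<close>

definition is_frame ::
  "('a::banach \<Rightarrow> 'a \<Rightarrow> 'k::scalar_field) \<Rightarrow> 'j set \<Rightarrow> ('j \<Rightarrow> 'a) \<Rightarrow> real \<Rightarrow> real \<Rightarrow> bool" where
  "is_frame ip J f A B \<longleftrightarrow> A > 0 \<and> B > 0 \<and>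
     (\<forall>g. (\<lambda>j. (norm (ip g (f j)))\<^sup>2) summable_on J \<and>
          A * (norm g)\<^sup>2 \<le> (\<Sum>\<^sub>\<infinity>j\<in>J. (norm (ip g (f j)))\<^sup>2) \<and>
          (\<Sum>\<^sub>\<infinity>j\<in>J. (norm (ip g (f j)))\<^sup>2) \<le> B * (norm g)\<^sup>2)"

definition frame_family ::
  "('a::banach \<Rightarrow> 'a \<Rightarrow> 'k::scalar_field) \<Rightarrow> 'i set \<Rightarrow> 'j set \<Rightarrow> ('i \<Rightarrow> 'j \<Rightarrow> 'a) \<Rightarrow> bool" where
  "frame_family ip I J F \<longleftrightarrow> (\<forall>i\<in>I. \<exists>A B. is_frame ip J (F i) A B)"

definition is_partition :: "'i set \<Rightarrow> 'j set \<Rightarrow> ('i \<Rightarrow> 'j set) \<Rightarrow> bool" where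
  "is_partition I J \<sigma> \<longleftrightarrow> disjoint_family_on \<sigma> I \<and> (\<Union>i\<in>I. \<sigma> i) = J"

text \<open>
  The family \<open>{f i j}\<close> with \<open>j \<in> \<sigma> i\<close> and \<open>i \<in> I\<close> is indexed by pairs \<open>(i, j)\<close>.
\<close>

definition woven ::
  "('a::banach \<Rightarrow> 'a \<Rightarrow> 'k::scalar_field) \<Rightarrow> 'i set \<Rightarrow> 'j set \<Rightarrow> ('i \<Rightarrow> 'j \<Rightarrow> 'a) \<Rightarrow> bool" where
  "woven ip I J F \<longleftrightarrow> frame_family ip I J F \<and>
     (\<exists>A'>0. \<exists>B'>0. \<forall>\<sigma>. is_partition I J \<sigma> \<longrightarrow>
        is_frame ip (SIGMA i:I. \<sigma> i) (\<lambda>(i, j). F i j) A' B')"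

end

theory Submission
  imports Defs
begin

text \<open>
  For \<open>g\<close> put \<open>z = U\<^sub>k\<^sup>* g\<close>. The lower frame bound of \<open>U\<^sub>k F\<close> makes \<open>U\<^sub>k\<^sup>*\<close> injective, and
  \<open>U\<^sub>k\<^sup>* V\<^sup>* = 1\<close>, so \<open>V\<^sup>* U\<^sub>k\<^sup>* = 1\<close> and \<open>\<parallel>g\<parallel> \<le> \<parallel>V\<parallel> \<parallel>z\<parallel>\<close>. Hence the coefficients of \<open>g\<close> against \<open>U\<^sub>k F\<close>
  have square sum at least \<open>\<alpha> \<parallel>g\<parallel>\<^sup>2\<close> with \<open>\<alpha> = A / \<parallel>V\<parallel>\<^sup>2\<close>. Replacing \<open>U\<^sub>k\<close> by \<open>U\<^sub>i\<close> on \<open>\<sigma>\<^sub>i\<close> for all \<open>i \<noteq> k\<close>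
  changes them by a sequence with square sum at most \<open>\<beta> \<parallel>g\<parallel>\<^sup>2\<close>, where
  \<open>\<beta> = (m - 1) B max \<parallel>U\<^sub>k - U\<^sub>i\<parallel>\<^sup>2 < \<alpha>\<close>, and the triangle inequality leaves a positive lower
  bound that does not depend on the partition.
\<close>

section \<open>Conjugation on the scalar field\<close>

lemma scalar_cnj_0 [simp]: "scalar_cnj 0 = (0::'k::scalar_field)"
  using scalar_cnj_add[of "0::'k" 0] by simp

lemma scalar_cnj_of_real [simp]: "scalar_cnj (of_real r) = (of_real r :: 'k::scalar_field)"
proof (cases "r = 0")
  case False
  have "of_real r * scalar_cnj (of_real r) = (of_real r * of_real r :: 'k)"
    using scalar_cnj_mult[of "of_real r :: 'k"]
    by (simp add: scaleR_conv_of_real power2_eq_square)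
  then show ?thesis using False by simp
qed simp

lemma norm_scalar_cnj [simp]: "norm (scalar_cnj x) = norm (x::'k::scalar_field)"
proof (cases "x = 0")
  case False
  have "norm (x * scalar_cnj x) = norm ((norm x)\<^sup>2 *\<^sub>R (1::'k))"
    by (simp only: scalar_cnj_mult)
  then have "norm x * norm (scalar_cnj x) = norm x * norm x"
    by (simp add: norm_mult power2_eq_square)
  then show ?thesis using False by simp
qed simp

section \<open>Inner product geometry up to the Cauchy-Schwarz inequality\<close>

context hilbert_space
begin

lemma ip_zero_left [simp]: "ip 0 y = 0"
  using ip_add_left[of 0 0 y] by simp

lemma ip_zero_right [simp]: "ip x 0 = 0"
  using ip_commute[of x 0] by simp

lemma ip_add_right: "ip x (y + z) = ip x y + ip x z"
  by (subst (1 2 3) ip_commute) (simp add: ip_add_left scalar_cnj_add)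

lemma ip_scl_right: "ip x (scl c y) = scalar_cnj c * ip x y"
  by (subst (1 2) ip_commute) (simp add: ip_scl_left scalar_cnj_times)

lemma ip_diff_left: "ip (x - y) z = ip x z - ip y z"
  using ip_add_left[of "x - y" y z] by simp

lemma ip_diff_right: "ip x (y - z) = ip x y - ip x z"
  using ip_add_right[of x "y - z" z] by simp

lemma norm_ip_commute: "norm (ip x y) = norm (ip y x)"
  using ip_commute[of x y] by simp

text \<open>The locale relates \<open>scl\<close> to the norm only through real scalars and through
  \<open>ip\<close>. Expanding the inner product of a multiple with itself, and injectivity of
  \<open>of_real\<close>, give homogeneity for all scalars.\<close>

lemma norm_scl: "norm (scl c x) = norm c * norm x"
proof -
  have "of_real ((norm (scl c x))\<^sup>2) = (of_real ((norm c * norm x)\<^sup>2) :: 'k)"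
    using scalar_cnj_mult[of c]
    unfolding ip_self[symmetric] ip_scl_left ip_scl_right
    by (simp add: ip_self scaleR_conv_of_real power_mult_distrib
          mult.assoc[symmetric] mult.commute[of _ c])
  then have "(norm (scl c x))\<^sup>2 = (norm c * norm x)\<^sup>2"
    by (simp only: of_real_eq_iff)
  then show ?thesis by (simp add: power2_eq_iff_nonneg)
qed

lemma parallelogram:
  fixes x y :: 'a
  shows "(norm (x + y))\<^sup>2 + (norm (x - y))\<^sup>2 = 2 * (norm x)\<^sup>2 + 2 * (norm y)\<^sup>2"
proof -
  have "of_real ((norm (x + y))\<^sup>2 + (norm (x - y))\<^sup>2)
      = (of_real ((norm x)\<^sup>2 + (norm x)\<^sup>2 + ((norm y)\<^sup>2 + (norm y)\<^sup>2)) :: 'k)"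
    unfolding of_real_add ip_self[symmetric]
    by (simp add: ip_add_left ip_add_right ip_diff_left ip_diff_right)
  then show ?thesis by (simp only: of_real_eq_iff mult_2)
qed

lemma pythagoras:
  assumes "ip x y = 0"
  shows "(norm (x + y))\<^sup>2 = (norm x)\<^sup>2 + (norm y)\<^sup>2"
proof -
  have "ip y x = 0" using assms ip_commute[of y x] by simp
  then have "of_real ((norm (x + y))\<^sup>2) = (of_real ((norm x)\<^sup>2 + (norm y)\<^sup>2) :: 'k)"
    unfolding of_real_add ip_self[symmetric] using assms
    by (simp add: ip_add_left ip_add_right)
  then show ?thesis by (simp only: of_real_eq_iff)
qed

text \<open>\<open>c\<close> is the coefficient of the projection of \<open>u\<close> to the line of
  \<open>h\<close>. Cauchy-Schwarz and the orthogonality argument for Riesz both rest on it. A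
  product in place of a quotient lets \<open>c = 0\<close> serve when \<open>h = 0\<close>.\<close>

lemma orthogonal_decomposition:
  obtains c where "ip u h = c * of_real ((norm h)\<^sup>2)"
    and "(norm u)\<^sup>2 = (norm (u - scl c h))\<^sup>2 + (norm c * norm h)\<^sup>2"
proof (cases "h = 0")
  case True
  then show ?thesis using that[of 0] by simp
next
  case False
  define c where "c = ip u h / of_real ((norm h)\<^sup>2)"
  have c: "ip u h = c * of_real ((norm h)\<^sup>2)" using False by (simp add: c_def)
  have "ip (u - scl c h) (scl c h) = 0"
    using c by (simp add: ip_diff_left ip_scl_right ip_scl_left ip_self)
  from pythagoras[OF this] show ?thesis using c that[of c] by (simp add: norm_scl)
qed

lemma Cauchy_Schwarz: "norm (ip x y) \<le> norm x * norm y"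
proof -
  obtain c where c: "ip x y = c * of_real ((norm y)\<^sup>2)"
    and n: "(norm x)\<^sup>2 = (norm (x - scl c y))\<^sup>2 + (norm c * norm y)\<^sup>2"
    by (rule orthogonal_decomposition)
  have "norm c * norm y \<le> norm x"
    by (rule power2_le_imp_le) (use n in auto)
  then have "norm c * norm y * norm y \<le> norm x * norm y"
    by (rule mult_right_mono) simp
  then show ?thesis using c by (simp add: norm_mult norm_power power2_eq_square mult.assoc)
qed

section \<open>Vectors of least norm and the Riesz representation\<close>

text \<open>Midpoints stay in \<open>M\<close>, so their norms cannot fall below the infimum; by the
  parallelogram law this makes a minimizing sequence Cauchy.\<close>

lemma closed_midpoint_convex_has_min_norm:
  fixes M :: "'a set"
  assumes "closed M" and "M \<noteq> {}"
    and mid: "\<And>x y. x \<in> M \<Longrightarrow> y \<in> M \<Longrightarrow> (1/2) *\<^sub>R (x + y) \<in> M"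
  obtains u where "u \<in> M" and "\<And>x. x \<in> M \<Longrightarrow> (norm u)\<^sup>2 \<le> (norm x)\<^sup>2"
proof -
  define d where "d = (INF x\<in>M. (norm x)\<^sup>2)"
  have bdd: "bdd_below ((\<lambda>x. (norm x)\<^sup>2) ` M)" by (rule bdd_belowI2[of _ 0]) simp
  have d: "d \<le> (norm x)\<^sup>2" if "x \<in> M" for x
    unfolding d_def using bdd that by (rule cINF_lower)
  have "\<exists>x\<in>M. (norm x)\<^sup>2 < d + 1 / real (Suc n)" for n
    using cINF_less_iff[OF \<open>M \<noteq> {}\<close> bdd, of "d + 1 / real (Suc n)"] by (simp add: d_def)
  then obtain X where XM: "\<And>n. X n \<in> M" and X: "\<And>n. (norm (X n))\<^sup>2 < d + 1 / real (Suc n)"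
    by metis
  have diff: "(norm (X n - X p))\<^sup>2 < 2 / real (Suc n) + 2 / real (Suc p)" for n p
  proof -
    \<comment> \<open>This is the bound \<open>d\<close> for the squared norm of the midpoint, times
      4. In the parallelogram law it cancels every \<open>d\<close> and leaves only the two
      errors.\<close>
    have "4 * d \<le> (norm (X n + X p))\<^sup>2"
      using d[OF mid[OF XM XM], of n p] by (simp add: power_mult_distrib power2_eq_square)
    then show ?thesis using parallelogram[of "X n" "X p"] X[of n] X[of p] by simp
  qed
  have "Cauchy X"
  proof (rule metric_CauchyI)
    fix e :: real assume "e > 0"
    then obtain N where N: "1 / real (Suc N) < e\<^sup>2 / 4"
      using nat_approx_posE[of "e\<^sup>2 / 4"] by auto
    show "\<exists>N. \<forall>n\<ge>N. \<forall>p\<ge>N. dist (X n) (X p) < e"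
    proof (intro exI allI impI)
      fix n p assume "n \<ge> N" "p \<ge> N"
      then have "1 / real (Suc n) \<le> 1 / real (Suc N)" "1 / real (Suc p) \<le> 1 / real (Suc N)"
        by (simp_all add: frac_le)
      then have "(norm (X n - X p))\<^sup>2 < e\<^sup>2" using diff[of n p] N by simp
      then show "dist (X n) (X p) < e"
        unfolding dist_norm by (rule power2_less_imp_less) (use \<open>e > 0\<close> in simp)
    qed
  qed
  then obtain u where u: "X \<longlonglongrightarrow> u" using Cauchy_convergent convergent_def by blast
  have "u \<in> M" using closed_sequentially[OF \<open>closed M\<close> XM u] .
  moreover have "(norm u)\<^sup>2 \<le> d"
  proof (rule LIMSEQ_le)
    show "(\<lambda>n. (norm (X n))\<^sup>2) \<longlonglongrightarrow> (norm u)\<^sup>2" by (intro tendsto_intros u)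
    show "(\<lambda>n. d + 1 / real (Suc n)) \<longlonglongrightarrow> d"
      using tendsto_add[OF tendsto_const[of d] lim_inverse_n'[THEN LIMSEQ_Suc]] by simp
    show "\<exists>N. \<forall>n\<ge>N. (norm (X n))\<^sup>2 \<le> d + 1 / real (Suc n)" using X less_imp_le by blast
  qed
  ultimately show ?thesis using that d by (meson order_trans)
qed

text \<open>The vector \<open>u\<close> of least norm on the hyperplane where \<open>\<phi>\<close>
  is 1 is orthogonal to the kernel of \<open>\<phi>\<close>, and together with the kernel it spans
  the space. A multiple of \<open>u\<close> therefore represents \<open>\<phi>\<close>.\<close>

lemma Riesz_representation:
  assumes add: "\<And>x y. \<phi> (x + y) = \<phi> x + \<phi> y"
    and scale: "\<And>c x. \<phi> (scl c x) = c * \<phi> x"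
    and bd: "\<And>x. norm (\<phi> x) \<le> C * norm x"
  obtains z where "\<And>x. \<phi> x = ip x z"
proof (cases "\<forall>x. \<phi> x = 0")
  case True
  then show ?thesis using that[of 0] by simp
next
  case False
  then obtain x0 where x0: "\<phi> x0 \<noteq> 0" by blast
  have scaleR: "\<phi> (r *\<^sub>R x) = r *\<^sub>R \<phi> x" for r x
    by (simp only: scl_of_real[symmetric] scale scaleR_conv_of_real)
  have "bounded_linear \<phi>"
    by (rule bounded_linear_intro[of _ C]) (simp_all add: add scaleR bd mult.commute)
  then have cont: "continuous_on UNIV \<phi>" by (rule linear_continuous_on)
  define M where "M = {x. \<phi> x = 1}"
  have "closed M" unfolding M_def by (rule closed_Collect_eq[OF cont]) simp
  moreover have "scl (1 / \<phi> x0) x0 \<in> M" using x0 by (simp add: M_def scale)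
  then have "M \<noteq> {}" by blast
  moreover have "(1/2) *\<^sub>R (x + y) \<in> M" if "x \<in> M" "y \<in> M" for x y
    using that by (simp add: M_def scaleR add scaleR_conv_of_real)
  ultimately obtain u where uM: "u \<in> M" and u: "\<And>x. x \<in> M \<Longrightarrow> (norm u)\<^sup>2 \<le> (norm x)\<^sup>2"
    by (rule closed_midpoint_convex_has_min_norm) blast+
  have \<phi>u: "\<phi> u = 1" using uM by (simp add: M_def)
  have diff: "\<phi> (x - y) = \<phi> x - \<phi> y" for x y using add[of "x - y" y] by simp
  have "u \<noteq> 0" using \<phi>u scaleR[of 0 0] by auto
  have orth: "ip u h = 0" if "\<phi> h = 0" for h
  proof -
    obtain c where c: "ip u h = c * of_real ((norm h)\<^sup>2)"
      and n: "(norm u)\<^sup>2 = (norm (u - scl c h))\<^sup>2 + (norm c * norm h)\<^sup>2"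
      by (rule orthogonal_decomposition)
    \<comment> \<open>Moving by a kernel vector stays on the hyperplane, so minimality of
      \<open>u\<close> forbids a component along \<open>h\<close>.\<close>
    have "u - scl c h \<in> M" using that \<phi>u by (simp add: M_def diff scale)
    then have "(norm c * norm h)\<^sup>2 \<le> 0" using u n by fastforce
    then show ?thesis using c by auto
  qed
  have key: "ip x u = \<phi> x * of_real ((norm u)\<^sup>2)" for x
  proof -
    have "\<phi> (x - scl (\<phi> x) u) = 0" using \<phi>u by (simp add: diff scale)
    from orth[OF this] have "ip (x - scl (\<phi> x) u) u = 0"
      using ip_commute[of "x - scl (\<phi> x) u" u] by simp
    then show ?thesis by (simp add: ip_diff_left ip_scl_left ip_self)
  qed
  \<comment> \<open>The factor is real, so conjugation in the second argument leaves it
    unchanged.\<close>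
  have "\<phi> x = ip x (scl (of_real (1 / (norm u)\<^sup>2)) u)" for x
    unfolding ip_scl_right key scalar_cnj_of_real using \<open>u \<noteq> 0\<close> by simp
  then show ?thesis by (rule that)
qed

section \<open>Adjoints and images of frames under operators\<close>

text \<open>\<open>z\<close> is the adjoint of \<open>T\<close> applied to \<open>g\<close>,
  produced by Riesz for one \<open>g\<close> at a time instead of as a value of an adjoint
  operator.\<close>

lemma adjoint_vector:
  assumes T: "bounded_operator scl T"
  obtains z where "\<And>x. ip (T x) g = ip x z" and "norm z \<le> onorm T * norm g"
proof -
  have bl: "bounded_linear T" and lin: "Vector_Spaces.linear scl scl T"
    using T by (auto simp: bounded_operator_def)
  have bd: "norm (ip (T x) g) \<le> (onorm T * norm g) * norm x" for x
  proof -
    have "norm (ip (T x) g) \<le> norm (T x) * norm g" by (rule Cauchy_Schwarz)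
    also have "\<dots> \<le> (onorm T * norm x) * norm g"
      by (intro mult_right_mono onorm[OF bl]) simp
    finally show ?thesis by (simp add: mult_ac)
  qed
  have "ip (T (x + y)) g = ip (T x) g + ip (T y) g" for x y
    using bl by (simp add: linear_simps ip_add_left)
  moreover have "ip (T (scl c x)) g = c * ip (T x) g" for c x
    using lin by (simp add: Vector_Spaces.linear_iff ip_scl_left)
  ultimately obtain z where z: "\<And>x. ip (T x) g = ip x z"
    using Riesz_representation[of "\<lambda>x. ip (T x) g", OF _ _ bd] by blast
  \<comment> \<open>Testing with \<open>x = z\<close> gives the squared norm of \<open>z\<close>;
    one factor cancels unless \<open>z = 0\<close>.\<close>
  have "norm z * norm z \<le> (onorm T * norm g) * norm z"
    using bd[of z] z[of z] by (simp add: ip_self norm_power power2_eq_square norm_mult)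
  then have "norm z \<le> onorm T * norm g"
    using onorm_pos_le[OF bl] by (cases "z = 0") simp_all
  with z show ?thesis by (rule that)
qed

lemma bounded_operator_diff:
  assumes "bounded_operator scl S" and "bounded_operator scl T"
  shows "bounded_operator scl (\<lambda>x. S x - T x)"
  using assms
  by (auto simp: bounded_operator_def Vector_Spaces.linear_iff bounded_linear_sub scale_right_diff_distrib)

text \<open>In absolute value, the coefficients of \<open>g\<close> against the image are those of
  the adjoint vector \<open>z\<close> against \<open>f\<close>, so the upper frame bound applies at
  \<open>z\<close>.\<close>

lemma Bessel_image:
  assumes frame: "is_frame ip J f A B" and T: "bounded_operator scl T"
  shows "(\<lambda>j. (norm (ip g (T (f j))))\<^sup>2) summable_on J"
    and "(\<Sum>\<^sub>\<infinity>j\<in>J. (norm (ip g (T (f j))))\<^sup>2) \<le> B * (onorm T)\<^sup>2 * (norm g)\<^sup>2"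
proof -
  obtain z where z: "\<And>x. ip (T x) g = ip x z" and nz: "norm z \<le> onorm T * norm g"
    using adjoint_vector[OF T] by blast
  have eq: "norm (ip g (T x)) = norm (ip z x)" for x
    using z[of x] norm_ip_commute by metis
  show "(\<lambda>j. (norm (ip g (T (f j))))\<^sup>2) summable_on J"
    using frame by (simp add: eq is_frame_def)
  have "(\<Sum>\<^sub>\<infinity>j\<in>J. (norm (ip g (T (f j))))\<^sup>2) \<le> B * (norm z)\<^sup>2"
    using frame by (simp add: eq is_frame_def)
  also have "\<dots> \<le> B * (onorm T * norm g)\<^sup>2"
    using frame nz by (intro mult_left_mono power_mono) (auto simp: is_frame_def)
  finally show "(\<Sum>\<^sub>\<infinity>j\<in>J. (norm (ip g (T (f j))))\<^sup>2) \<le> B * (onorm T)\<^sup>2 * (norm g)\<^sup>2"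
    by (simp add: power_mult_distrib mult.assoc)
qed

lemma frame_image_lower_bound:
  assumes frame: "is_frame ip J f A B"
    and T: "bounded_operator scl T" and V: "bounded_operator scl V" and VT: "V \<circ> T = id"
    and image: "is_frame ip J (\<lambda>j. T (f j)) A1 B1"
  shows "A * (norm g)\<^sup>2 \<le> (onorm V)\<^sup>2 * (\<Sum>\<^sub>\<infinity>j\<in>J. (norm (ip g (T (f j))))\<^sup>2)"
proof -
  obtain z where z: "\<And>x. ip (T x) g = ip x z"
    using adjoint_vector[OF T] by blast
  obtain w where w: "\<And>x. ip (V x) z = ip x w" and nw: "norm w \<le> onorm V * norm z"
    using adjoint_vector[OF V] by blast
  \<comment> \<open>\<open>w\<close> is the adjoint of \<open>V\<close> applied to \<open>z\<close>.
    As \<open>V\<close> undoes \<open>T\<close>, \<open>w\<close> and \<open>g\<close> have the same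
    inner products with the range of \<open>T\<close>.\<close>
  have "ip (T x) (w - g) = 0" for x
    using w[of "T x"] z[of x] VT by (simp add: ip_diff_right fun_eq_iff)
  then have "norm (ip (w - g) (T x)) = 0" for x
    using norm_ip_commute by (metis norm_zero)
  \<comment> \<open>All coefficients of \<open>w - g\<close> against the image frame vanish, so its
    lower bound forces \<open>w = g\<close>. Only positivity of \<open>A1\<close> enters, not its
    size.\<close>
  then have "A1 * (norm (w - g))\<^sup>2 \<le> 0" and "A1 > 0"
    using image by (auto simp: is_frame_def dest: spec[of _ "w - g"])
  then have "w = g" by (simp add: mult_le_0_iff)
  have eq: "norm (ip g (T x)) = norm (ip z x)" for x
    using z[of x] norm_ip_commute by metis
  have "A > 0" using frame by (simp add: is_frame_def)
  then have "A * (norm g)\<^sup>2 \<le> A * (onorm V * norm z)\<^sup>2"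
    using nw \<open>w = g\<close> by (intro mult_left_mono power_mono) auto
  also have "\<dots> = (onorm V)\<^sup>2 * (A * (norm z)\<^sup>2)" by (simp add: power_mult_distrib)
  also have "\<dots> \<le> (onorm V)\<^sup>2 * (\<Sum>\<^sub>\<infinity>j\<in>J. (norm (ip z (f j)))\<^sup>2)"
    using frame by (intro mult_left_mono) (auto simp: is_frame_def)
  finally show ?thesis by (simp add: eq)
qed

end

section \<open>Reindexing partitions, finite sums of series, and a weighted inequality\<close>

text \<open>\<open>\<tau> j\<close> names the cell containing \<open>j\<close>: it exists by
  covering and is unique by disjointness. The bijection turns sums over pairs into sums over the
  fixed set \<open>J\<close>, where they can be compared with the original families.\<close>

lemma partition_index:
  assumes "is_partition I J \<sigma>"
  obtains \<tau> where "\<And>j. j \<in> J \<Longrightarrow> \<tau> j \<in> I" and "bij_betw (\<lambda>j. (\<tau> j, j)) J (SIGMA i:I. \<sigma> i)"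
proof -
  have un: "(\<Union>i\<in>I. \<sigma> i) = J" and disj: "disjoint_family_on \<sigma> I"
    using assms by (auto simp: is_partition_def)
  have "\<forall>j\<in>J. \<exists>i. i \<in> I \<and> j \<in> \<sigma> i" using un by blast
  then obtain \<tau> where \<tau>: "\<And>j. j \<in> J \<Longrightarrow> \<tau> j \<in> I \<and> j \<in> \<sigma> (\<tau> j)" by metis
  have eq: "\<tau> j = i" if "i \<in> I" "j \<in> \<sigma> i" for i j
    using that disj \<tau>[of j] un by (force simp: disjoint_family_on_def)
  have "bij_betw (\<lambda>j. (\<tau> j, j)) J (SIGMA i:I. \<sigma> i)"
    unfolding bij_betw_def
  proof
    show "inj_on (\<lambda>j. (\<tau> j, j)) J" by (auto simp: inj_on_def)
    show "(\<lambda>j. (\<tau> j, j)) ` J = (SIGMA i:I. \<sigma> i)"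
    proof (intro equalityI subsetI)
      fix p assume p: "p \<in> (SIGMA i:I. \<sigma> i)"
      then obtain i j where "p = (i, j)" "i \<in> I" "j \<in> \<sigma> i" by blast
      moreover from this have "j \<in> J" using un by blast
      ultimately show "p \<in> (\<lambda>j. (\<tau> j, j)) ` J" using eq by force
    qed (use \<tau> in auto)
  qed
  with \<tau> show ?thesis using that by blast
qed

lemma has_sum_finite_sum:
  fixes f :: "'i \<Rightarrow> 'j \<Rightarrow> 'a::{topological_comm_monoid_add}"
  assumes "finite I" and "\<And>i. i \<in> I \<Longrightarrow> (f i has_sum s i) J"
  shows "((\<lambda>j. \<Sum>i\<in>I. f i j) has_sum (\<Sum>i\<in>I. s i)) J"
  using assms by (induction I rule: finite_induct) (simp_all add: has_sum_add)

lemma summable_on_finite_sum: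
  fixes f :: "'i \<Rightarrow> 'j \<Rightarrow> 'a::{topological_comm_monoid_add, t2_space}"
  assumes "finite I" and "\<And>i. i \<in> I \<Longrightarrow> f i summable_on J"
  shows "(\<lambda>j. \<Sum>i\<in>I. f i j) summable_on J"
  using has_sum_finite_sum[OF assms(1) has_sum_infsum[OF assms(2)]]
  by (rule has_sum_imp_summable)

lemma infsum_finite_sum:
  fixes f :: "'i \<Rightarrow> 'j \<Rightarrow> 'a::{topological_comm_monoid_add, t2_space}"
  assumes "finite I" and "\<And>i. i \<in> I \<Longrightarrow> f i summable_on J"
  shows "(\<Sum>\<^sub>\<infinity>j\<in>J. \<Sum>i\<in>I. f i j) = (\<Sum>i\<in>I. infsum (f i) J)"
  using has_sum_finite_sum[OF assms(1) has_sum_infsum[OF assms(2)]]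
  by (rule infsumI)

text \<open>A small \<open>t\<close> keeps the factor of \<open>b\<^sup>2\<close> near 1, at the
  price of a large factor on \<open>c\<^sup>2\<close>. Equal factors 2 would suffice below only when
  \<open>2 * \<beta> < \<alpha>\<close>.\<close>

lemma weighted_square_triangle:
  fixes a b c t :: real
  assumes "0 \<le> a" and "a \<le> b + c" and "t > 0"
  shows "a\<^sup>2 \<le> (1 + t) * b\<^sup>2 + (1 + 1 / t) * c\<^sup>2"
proof -
  have "a\<^sup>2 \<le> (b + c)\<^sup>2" using assms by (intro power_mono) auto
  moreover have "0 \<le> (t * b - c)\<^sup>2 / t" using \<open>t > 0\<close> by simp
  moreover have "(1 + t) * b\<^sup>2 + (1 + 1 / t) * c\<^sup>2 - (b + c)\<^sup>2 = (t * b - c)\<^sup>2 / t"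
    using \<open>t > 0\<close> by (simp add: field_simps power2_eq_square)
  ultimately show ?thesis by linarith
qed

section \<open>Weaving under small perturbations\<close>

context hilbert_space
begin

text \<open>The weight \<open>t\<close> below is chosen so that \<open>(1 + t) \<beta> \<le> (\<alpha> + \<beta>) / 2 < \<alpha>\<close>.\<close>

lemma woven_of_small_perturbation:
  assumes "finite I"
    and frames: "frame_family ip I J F"
    and "k \<in> I" and "0 \<le> \<beta>" and "\<beta> < \<alpha>"
    and lower: "\<And>g. \<alpha> * (norm g)\<^sup>2 \<le> (\<Sum>\<^sub>\<infinity>j\<in>J. (norm (ip g (F k j)))\<^sup>2)"
    and pert_summable: "\<And>i g. i \<in> I - {k} \<Longrightarrow>
      (\<lambda>j. (norm (ip g (F k j - F i j)))\<^sup>2) summable_on J"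
    and pert: "\<And>g. (\<Sum>i\<in>I - {k}. \<Sum>\<^sub>\<infinity>j\<in>J. (norm (ip g (F k j - F i j)))\<^sup>2) \<le> \<beta> * (norm g)\<^sup>2"
  shows "woven ip I J F"
proof -
  obtain AA BB where fr: "\<And>i. i \<in> I \<Longrightarrow> is_frame ip J (F i) (AA i) (BB i)"
    using frames unfolding frame_family_def by metis
  define t where "t = (\<alpha> - \<beta>) / (2 * \<alpha>)"
  \<comment> \<open>The part of the lower bound that survives the perturbation, divided by the
    factor that the weighted inequality puts on the woven coefficients.\<close>
  define A' where "A' = ((\<alpha> - \<beta>) / 2) / (1 + 1 / t)"
  \<comment> \<open>Each woven coefficient occurs in one of the families, so the sum of all upper
    bounds serves every partition.\<close>
  define B' where "B' = (\<Sum>i\<in>I. BB i)"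
  have "\<alpha> > 0" using \<open>0 \<le> \<beta>\<close> \<open>\<beta> < \<alpha>\<close> by simp
  have t: "t > 0" using \<open>\<alpha> > 0\<close> \<open>\<beta> < \<alpha>\<close> by (simp add: t_def)
  have "\<beta> / \<alpha> \<le> 1" using \<open>\<alpha> > 0\<close> \<open>\<beta> < \<alpha>\<close> by simp
  have "t * \<beta> = (\<alpha> - \<beta>) / 2 * (\<beta> / \<alpha>)" by (simp add: t_def)
  also have "\<dots> \<le> (\<alpha> - \<beta>) / 2 * 1"
    using \<open>\<beta> < \<alpha>\<close> \<open>\<beta> / \<alpha> \<le> 1\<close> by (intro mult_left_mono) auto
  finally have t\<beta>: "(1 + t) * \<beta> \<le> (\<alpha> + \<beta>) / 2" by (simp add: field_simps)
  have t1: "1 + 1 / t > 0" using t by (simp add: add_pos_pos)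
  then have "A' > 0" using \<open>\<beta> < \<alpha>\<close> by (simp add: A'_def)
  have "B' > 0" unfolding B'_def
    using fr \<open>finite I\<close> \<open>k \<in> I\<close> by (intro sum_pos) (auto simp: is_frame_def)
  have "is_frame ip (SIGMA i:I. \<sigma> i) (\<lambda>(i, j). F i j) A' B'" if part: "is_partition I J \<sigma>" for \<sigma>
  proof -
    obtain \<tau> where \<tau>: "\<And>j. j \<in> J \<Longrightarrow> \<tau> j \<in> I"
      and bij: "bij_betw (\<lambda>j. (\<tau> j, j)) J (SIGMA i:I. \<sigma> i)"
      using partition_index[OF part] by blast
    have "(\<lambda>p. (norm (ip g ((\<lambda>(i, j). F i j) p)))\<^sup>2) summable_on (SIGMA i:I. \<sigma> i) \<and>
       A' * (norm g)\<^sup>2 \<le> (\<Sum>\<^sub>\<infinity>p\<in>(SIGMA i:I. \<sigma> i). (norm (ip g ((\<lambda>(i, j). F i j) p)))\<^sup>2) \<and>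
       (\<Sum>\<^sub>\<infinity>p\<in>(SIGMA i:I. \<sigma> i). (norm (ip g ((\<lambda>(i, j). F i j) p)))\<^sup>2) \<le> B' * (norm g)\<^sup>2" for g
    proof -
      define a where "a = (\<lambda>i j. (norm (ip g (F i j)))\<^sup>2)"
      define b where "b = (\<lambda>i j. (norm (ip g (F k j - F i j)))\<^sup>2)"
      \<comment> \<open>The squared coefficients of the woven family, indexed by \<open>J\<close>
        through \<open>\<tau>\<close>.\<close>
      define c where "c = (\<lambda>j. a (\<tau> j) j)"
      have a_sum: "a i summable_on J" if "i \<in> I" for i
        using fr[OF that] by (simp add: a_def is_frame_def)
      have a_le: "infsum (a i) J \<le> BB i * (norm g)\<^sup>2" if "i \<in> I" for i
        using fr[OF that] by (simp add: a_def is_frame_def)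
      have b_sum: "b i summable_on J" if "i \<in> I - {k}" for i
        using pert_summable[OF that] by (simp add: b_def)
      have sa: "(\<lambda>j. \<Sum>i\<in>I. a i j) summable_on J"
        using a_sum by (intro summable_on_finite_sum) (simp_all add: \<open>finite I\<close>)
      have sb: "(\<lambda>j. \<Sum>i\<in>I - {k}. b i j) summable_on J"
        using b_sum by (intro summable_on_finite_sum) (simp_all add: \<open>finite I\<close>)
      have c_le: "c j \<le> (\<Sum>i\<in>I. a i j)" if "j \<in> J" for j
        unfolding c_def using \<tau>[OF that] \<open>finite I\<close>
        by (intro member_le_sum) (auto simp: a_def)
      have sc: "c summable_on J"
        by (rule summable_on_comparison_test[OF sa]) (use c_le in \<open>simp_all add: c_def a_def\<close>)
      have le_k: "a k j \<le> (1 + t) * (\<Sum>i\<in>I - {k}. b i j) + (1 + 1 / t) * c j" if "j \<in> J" for j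
      proof -
        have "norm (ip g (F k j)) \<le> norm (ip g (F k j - F (\<tau> j) j)) + norm (ip g (F (\<tau> j) j))"
          using norm_triangle_ineq[of "ip g (F k j - F (\<tau> j) j)" "ip g (F (\<tau> j) j)"]
          by (simp add: ip_diff_right)
        then have "a k j \<le> (1 + t) * b (\<tau> j) j + (1 + 1 / t) * c j"
          unfolding a_def b_def c_def by (intro weighted_square_triangle t) auto
        \<comment> \<open>For \<open>\<tau> j = k\<close> the left side is 0, since nothing was
          replaced there; otherwise it is one of the summands. The right side no longer depends on
          the partition.\<close>
        moreover have "b (\<tau> j) j \<le> (\<Sum>i\<in>I - {k}. b i j)"
        proof (cases "\<tau> j = k")
          case True
          then show ?thesis by (simp add: b_def sum_nonneg)
        next
          case False
          then show ?thesis using \<tau>[OF that] \<open>finite I\<close>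
            by (intro member_le_sum) (auto simp: b_def)
        qed
        ultimately show ?thesis
          using t mult_left_mono[of "b (\<tau> j) j" "\<Sum>i\<in>I - {k}. b i j" "1 + t"] by linarith
      qed
      have "\<alpha> * (norm g)\<^sup>2 \<le> infsum (a k) J" using lower by (simp add: a_def)
      also have "\<dots> \<le> (\<Sum>\<^sub>\<infinity>j\<in>J. (1 + t) * (\<Sum>i\<in>I - {k}. b i j) + (1 + 1 / t) * c j)"
        by (intro infsum_mono a_sum \<open>k \<in> I\<close> summable_on_add summable_on_cmult_right sb sc le_k)
      also have "\<dots> = (1 + t) * (\<Sum>i\<in>I - {k}. infsum (b i) J) + (1 + 1 / t) * infsum c J"
        using infsum_finite_sum[of "I - {k}" b J, OF _ b_sum] \<open>finite I\<close>
        by (simp add: infsum_add summable_on_cmult_right sb sc infsum_cmult_right)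
      also have "\<dots> \<le> (1 + t) * (\<beta> * (norm g)\<^sup>2) + (1 + 1 / t) * infsum c J"
        using pert[of g] t by (intro add_right_mono mult_left_mono) (auto simp: b_def)
      also have "\<dots> \<le> (\<alpha> + \<beta>) / 2 * (norm g)\<^sup>2 + (1 + 1 / t) * infsum c J"
        using mult_right_mono[OF t\<beta>, of "(norm g)\<^sup>2"] by (simp add: mult.assoc)
      finally have "(\<alpha> - \<beta>) / 2 * (norm g)\<^sup>2 \<le> (1 + 1 / t) * infsum c J"
        by (simp add: field_simps)
      then have low: "A' * (norm g)\<^sup>2 \<le> infsum c J"
        using t1 unfolding A'_def
        by (metis mult.commute pos_divide_le_eq times_divide_eq_left)
      have "infsum c J \<le> (\<Sum>\<^sub>\<infinity>j\<in>J. \<Sum>i\<in>I. a i j)"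
        by (intro infsum_mono sc sa c_le)
      also have "\<dots> = (\<Sum>i\<in>I. infsum (a i) J)" using a_sum by (simp add: infsum_finite_sum \<open>finite I\<close>)
      also have "\<dots> \<le> (\<Sum>i\<in>I. BB i * (norm g)\<^sup>2)" by (intro sum_mono a_le)
      also have "\<dots> = B' * (norm g)\<^sup>2" by (simp add: B'_def sum_distrib_right)
      finally have up: "infsum c J \<le> B' * (norm g)\<^sup>2" .
      have c_eq: "c = (\<lambda>j. (norm (ip g ((\<lambda>(i, j). F i j) (\<tau> j, j))))\<^sup>2)"
        by (simp add: c_def a_def)
      show ?thesis
        using sc low up unfolding c_eq
          summable_on_reindex_bij_betw[OF bij, of "\<lambda>p. (norm (ip g ((\<lambda>(i, j). F i j) p)))\<^sup>2"]
          infsum_reindex_bij_betw[OF bij, of "\<lambda>p. (norm (ip g ((\<lambda>(i, j). F i j) p)))\<^sup>2"]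
        by blast
    qed
    then show ?thesis using \<open>A' > 0\<close> \<open>B' > 0\<close> unfolding is_frame_def by blast
  qed
  then show ?thesis using frames \<open>A' > 0\<close> \<open>B' > 0\<close> unfolding woven_def by blast
qed

end

section \<open>Operator images of a frame as small perturbations\<close>

theorem theorem2p7:
  fixes scl :: "'k::scalar_field \<Rightarrow> 'a::banach \<Rightarrow> 'a"
    and ip :: "'a \<Rightarrow> 'a \<Rightarrow> 'k"
    and J :: "'j set" and f :: "'j \<Rightarrow> 'a"
    and U :: "nat \<Rightarrow> 'a \<Rightarrow> 'a" and V :: "'a \<Rightarrow> 'a"
    and A B :: real and m k :: nat
  assumes "hilbert_space scl ip"
    and "separable_space (euclidean :: 'a topology)"
    and "countable J"
    and "m \<ge> 2"
    and "is_frame ip J f A B"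
    and "\<And>i. i \<in> {1..m} \<Longrightarrow> bounded_operator scl (U i)"
    and "frame_family ip {1..m} J (\<lambda>i j. U i (f j))"
    and "k \<in> {1..m}"
    and "bounded_operator scl V"
    and "V \<circ> U k = id"
    and "Max ((\<lambda>i. onorm (\<lambda>x. U k x - U i x)) ` ({1..m} - {k}))
           < sqrt (A / ((real m - 1) * B)) * (1 / onorm V)"
  shows "woven ip {1..m} J (\<lambda>i j. U i (f j))"
proof -
  interpret hilbert_space scl ip by fact
  let ?I = "{1..m} - {k}"
  define D where "D = Max ((\<lambda>i. onorm (\<lambda>x. U k x - U i x)) ` ?I)"
  define v where "v = onorm V"
  have A: "A > 0" and B: "B > 0" using assms(5) by (auto simp: is_frame_def)
  have m: "real m - 1 > 0" using assms(4) by simp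
  have card: "real (card ?I) = real m - 1" using assms(4,8) by (simp add: of_nat_diff)
  then have "card ?I \<noteq> 0" using m by linarith
  then have "?I \<noteq> {}" by (metis card.empty)
  \<comment> \<open>An index other than \<open>k\<close> makes the set under \<open>Max\<close>
    nonempty and yields \<open>0 \<le> D\<close>.\<close>
  then obtain i0 where i0: "i0 \<in> ?I" by blast
  have op: "bounded_operator scl (\<lambda>x. U k x - U i x)" if "i \<in> ?I" for i
    using that assms(6,8) by (intro bounded_operator_diff) auto
  have pos: "0 \<le> onorm (\<lambda>x. U k x - U i x)" if "i \<in> ?I" for i
    using op[OF that] by (intro onorm_pos_le) (simp add: bounded_operator_def)
  have D: "onorm (\<lambda>x. U k x - U i x) \<le> D" if "i \<in> ?I" for i
    unfolding D_def using that by (intro Max_ge) auto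
  have "0 \<le> D" using pos[OF i0] D[OF i0] by linarith
  have less: "D < sqrt (A / ((real m - 1) * B)) * (1 / v)"
    using assms(11) by (simp add: D_def v_def)
  \<comment> \<open>Division by zero gives 0, so \<open>v = 0\<close> would turn the hypothesis into
    \<open>D < 0\<close>.\<close>
  have "v > 0"
  proof -
    have "v \<noteq> 0"
    proof
      assume "v = 0"
      then show False using less \<open>0 \<le> D\<close> by simp
    qed
    moreover have "v \<ge> 0"
      unfolding v_def using assms(9) by (intro onorm_pos_le) (simp add: bounded_operator_def)
    ultimately show ?thesis by simp
  qed
  \<comment> \<open>Squaring the hypothesis gives \<open>\<beta> < \<alpha>\<close> for
    \<open>\<beta> = (real m - 1) * B * D\<^sup>2\<close> and
    \<open>\<alpha> = A / v\<^sup>2\<close>.\<close>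
  have "D\<^sup>2 < (sqrt (A / ((real m - 1) * B)) * (1 / v))\<^sup>2"
    using less \<open>0 \<le> D\<close> by (intro power_strict_mono) auto
  also have "\<dots> = A / ((real m - 1) * B) / v\<^sup>2"
    using A B m by (simp add: power_mult_distrib power_divide)
  finally have D2: "(real m - 1) * B * D\<^sup>2 < A / v\<^sup>2"
    using B m \<open>v > 0\<close> by (simp add: field_simps)
  obtain A1 B1 where image: "is_frame ip J (\<lambda>j. U k (f j)) A1 B1"
    using assms(7,8) unfolding frame_family_def by blast
  show ?thesis
  proof (rule woven_of_small_perturbation[where k = k])
    show "0 \<le> (real m - 1) * B * D\<^sup>2" using B m by simp
    show "A / v\<^sup>2 * (norm g)\<^sup>2 \<le> (\<Sum>\<^sub>\<infinity>j\<in>J. (norm (ip g (U k (f j))))\<^sup>2)" for g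
      using frame_image_lower_bound[OF assms(5) assms(6)[OF assms(8)] assms(9,10) image, of g]
        \<open>v > 0\<close>
      by (simp add: v_def[symmetric] pos_divide_le_eq mult.commute)
    show "(\<lambda>j. (norm (ip g (U k (f j) - U i (f j))))\<^sup>2) summable_on J" if "i \<in> ?I" for i g
      using Bessel_image(1)[OF assms(5) op[OF that]] .
    show "(\<Sum>i\<in>?I. \<Sum>\<^sub>\<infinity>j\<in>J. (norm (ip g (U k (f j) - U i (f j))))\<^sup>2)
        \<le> (real m - 1) * B * D\<^sup>2 * (norm g)\<^sup>2" for g
    proof -
      have "(\<Sum>\<^sub>\<infinity>j\<in>J. (norm (ip g (U k (f j) - U i (f j))))\<^sup>2) \<le> B * D\<^sup>2 * (norm g)\<^sup>2"
        if "i \<in> ?I" for i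
      proof -
        have "(onorm (\<lambda>x. U k x - U i x))\<^sup>2 \<le> D\<^sup>2"
          using pos[OF that] D[OF that] by (intro power_mono)
        then have "B * (onorm (\<lambda>x. U k x - U i x))\<^sup>2 * (norm g)\<^sup>2 \<le> B * D\<^sup>2 * (norm g)\<^sup>2"
          using B by (intro mult_right_mono mult_left_mono) auto
        then show ?thesis
          using Bessel_image(2)[OF assms(5) op[OF that], of g] by linarith
      qed
      \<comment> \<open>The \<open>m - 1\<close> indices other than \<open>k\<close> share one
        bound; their number is the factor in the hypothesis.\<close>
      from sum_bounded_above[of ?I, OF this] show ?thesis
        unfolding card by (simp add: mult.assoc)
    qed
  qed (use assms(7,8) D2 in auto)
qed

end
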